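(* Let $Q$ and $k$ be integers $\ge 1$ and let $I$ be an interval in $\mathbf{Z}$ of length $N$. When $\mathcal{F}(Q)$ is the Farey sequence of order $Q$ and $P(T) = c_0T^k + c_1T^{k-1} + \ldots + c_k$ is a polynomial of degree $k$ in $\mathbf{Z}[T]$, we have the inequality $$\sum_{x \in \mathcal{F}(Q)} \left| \sum_{i \in I} a_i\, e(xP(i)) \right|^2 \;\ll\; Q(N+Q)(\log Q)^{\omega(c_0) + \theta(k)} \, \|a\|^2$$ for every sequence of complex numbers $\{a_i\}_{i \in I}$, where the constant implicit in the $\ll$ depends only on $k$.
   Context: Notation: $e(z) = e^{2\pi i z}$. $\mathcal{F}(Q)$, the Farey sequence of order $Q$, is the set of rationals $p/q$ with $1 \le q \le Q$, $0 \le p \le q-1$ and $\gcd(p,q) = 1$. $\omega(n)$ is the number of prime divisors of $n$. $\theta(k) = k\binom{k+1}{2}$. $\|a\|^2 = \sum_{i \in I} |a_i|^2$. An interval in $\mathbf{Z}$ of length $N$ is a set of $N$ consecutive integers. $A \ll B$ means $|A| \le C B$ for some constant $C > 0$ (the implicit constant).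
   Formalization: log Q is replaced by max(1, log Q), which changes only Q = 1 and Q = 2, where the inequality as stated fails: log 1 = 0, and powers of log 2 < 1 tend to 0 as ω(c_0) grows while the constant depends only on k. *)

theory Defs
  imports Complex_Main "HOL-Computational_Algebra.Computational_Algebra"
begin

definition e :: "complex \<Rightarrow> complex" where
  "e z = exp (2 * of_real pi * \<i> * z)"

(* 0 = 0/1 belongs to every farey Q with Q >= 1, since coprime 0 1. *)
definition farey :: "nat \<Rightarrow> rat set" where
  "farey Q = {of_int p / of_int q | p q :: int.
     1 \<le> q \<and> q \<le> int Q \<and> 0 \<le> p \<and> p \<le> q - 1 \<and> coprime p q}"

lemma finite_farey: "finite (farey Q)"
proof (rule finite_subset)
  show "farey Q \<subseteq> (\<lambda>(p, q). of_int p / of_int q) ` ({0..int Q} \<times> {0..int Q})"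
    by (fastforce simp: farey_def image_iff)
qed auto

(* On int, prime_factors consists of positive primes, so the sign of n is irrelevant. *)
definition omega :: "int \<Rightarrow> nat" where
  "omega n = card (prime_factors n)"

definition theta :: "nat \<Rightarrow> nat" where
  "theta k = k * ((k + 1) choose 2)"

definition interval_of_length :: "int set \<Rightarrow> nat \<Rightarrow> bool" where
  "interval_of_length I N \<longleftrightarrow> (\<exists>m. I = {m..<m + int N})"

definition norm_sq :: "int set \<Rightarrow> (int \<Rightarrow> complex) \<Rightarrow> real" where
  "norm_sq I a = (\<Sum>i\<in>I. (cmod (a i))\<^sup>2)"

(* The logarithm in the bound is log Q for Q >= 3 and 1 for Q = 1, 2.  A bare power of log Q
   cannot serve there: log 1 = 0, and log 2 < 1 has powers tending to 0 as the exponent, which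
   involves the number of prime divisors of the leading coefficient, grows, whereas the
   implied constant must not depend on that coefficient. *)
definition log1 :: "nat \<Rightarrow> real" where
  "log1 Q = max 1 (ln (real Q))"

lemma log1_eq_ln:
  assumes "Q \<ge> 3"
  shows "log1 Q = ln (real Q)"
proof -
  have "exp 1 \<le> real Q"
    using exp_le assms by linarith
  then have "1 \<le> ln (real Q)"
    using assms by (subst ln_ge_iff) auto
  then show ?thesis
    by (simp add: log1_def)
qed

end

theory Submission imports Defs "HOL-Analysis.Harmonic_Numbers" begin

text \<open>Complete the sum over fractions of denominator \<open>q\<close> to all residues modulo \<open>q\<close>. Orthogonality and
  \<open>2 \<bar>a\<^sub>i a\<^sub>j\<bar> \<le> \<bar>a\<^sub>i\<bar>\<^sup>2 + \<bar>a\<^sub>j\<bar>\<^sup>2\<close> reduce the theorem to bounding, for each \<open>i\<close>, the number of pairs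
  \<open>(q, j)\<close> with \<open>q\<close> dividing \<open>f(j) = P(j) - P(i)\<close>. Write \<open>q = q\<^sub>1 q\<^sub>2\<close>, where \<open>q\<^sub>1\<close> is composed of primes
  dividing \<open>c\<^sub>0\<close> and \<open>q\<^sub>2\<close> is coprime to \<open>c\<^sub>0\<close>; there are \<open>O((log Q)^\<omega>(c\<^sub>0))\<close> choices of \<open>q\<^sub>1\<close>.
  With \<open>b = (k+1 choose 2)\<close>, a Vandermonde determinant shows that, for \<open>p\<close> not dividing \<open>c\<^sub>0\<close>, the
  roots of \<open>f\<close> modulo \<open>p^m\<close> lie in at most \<open>k\<close> classes modulo \<open>p^\<lceil>m/b\<rceil>\<close>. Hence those modulo \<open>q\<^sub>2\<close> lie
  in at most \<open>k^\<omega>(d)\<close> classes modulo the product \<open>d\<close> of these prime powers. Each \<open>d\<close> arises from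
  at most \<open>b^\<omega>(d)\<close> values of \<open>q\<^sub>2\<close>, and the sum of \<open>(k b)^\<omega>(d) / d\<close> over \<open>d \<le> Q\<close> is at most the
  power of exponent \<open>k b = \<theta>(k)\<close> of the harmonic sum.\<close>

section \<open>Roots of a polynomial modulo a prime power\<close>

text \<open>Divided differences: with \<open>c\<close> the last node, the quotient \<open>g\<close>
  of \<open>f - f(c)\<close> by \<open>T - c\<close> has the top coefficient of \<open>f\<close> and
  satisfies \<open>(c - x j) * g(x j) = f(c) - f(x j)\<close>, which \<open>n\<close> divides. The
  induction passes from \<open>f\<close> to \<open>D * g\<close>, where \<open>D\<close> collects
  the Vandermonde factors that involve \<open>c\<close>.\<close>

lemma dvd_vandermonde_if_dvd_values:
  fixes f :: "'a::comm_ring_1 poly" and x :: "nat \<Rightarrow> 'a"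
  assumes "degree f \<le> k" "\<And>j. j \<le> k \<Longrightarrow> n dvd poly f (x j)"
  shows "n dvd coeff f k * (\<Prod>j\<le>k. \<Prod>i<j. x j - x i)"
  using assms
proof (induction k arbitrary: f)
  case 0
  then obtain b where "f = [:b:]"
    by (auto elim: degree_eq_zeroE)
  then show ?case
    using "0.prems"(2)[of 0] by simp
next
  case (Suc k)
  define c where "c = x (Suc k)"
  define g where "g = synthetic_div f c"
  define D where "D = (\<Prod>i<Suc k. c - x i)"
  have deg: "degree g \<le> k"
    using Suc.prems(1) by (simp add: g_def degree_synthetic_div)
  have f: "f + smult c g = pCons (poly f c) g"
    unfolding g_def by (rule synthetic_div_correct)
  have "coeff (f + smult c g) (Suc k) = coeff g k"
    by (subst f) simp
  then have lead: "coeff f (Suc k) = coeff g k"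
    using deg by (simp add: coeff_eq_0)
  \<comment> \<open>In general \<open>c - x j\<close> cannot be cancelled modulo \<open>n\<close>,
    so these factors are carried along, all together, in \<open>D\<close>.\<close>
  have "n dvd poly (smult D g) (x j)" if "j \<le> k" for j
  proof -
    have "poly f (x j) + c * poly g (x j) = poly f c + x j * poly g (x j)"
      using arg_cong[OF f, of "\<lambda>h. poly h (x j)"] by simp
    then have "(c - x j) * poly g (x j) = poly f c - poly f (x j)"
      by (simp add: algebra_simps)
    moreover have "n dvd poly f c - poly f (x j)"
      using Suc.prems(2)[of j] Suc.prems(2)[of "Suc k"] that by (simp add: c_def)
    ultimately have n: "n dvd (c - x j) * poly g (x j)"
      by simp
    have "(c - x j) dvd D"
      unfolding D_def using that by (intro dvd_prodI) auto
    then have "(c - x j) * poly g (x j) dvd D * poly g (x j)"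
      by (rule mult_dvd_mono) simp
    with n show ?thesis
      by (auto intro: dvd_trans)
  qed
  with deg have "n dvd coeff (smult D g) k * (\<Prod>j\<le>k. \<Prod>i<j. x j - x i)"
    by (intro Suc.IH) (auto intro: order_trans[OF degree_smult_le])
  then show ?case
    by (simp add: lead D_def c_def mult_ac)
qed

lemma multiplicity_prod_le:
  fixes g :: "'b \<Rightarrow> 'a::factorial_semiring"
  assumes "prime p" "finite A" "\<And>a. a \<in> A \<Longrightarrow> \<not> p ^ Suc s dvd g a"
  shows "multiplicity p (prod g A) \<le> card A * s"
proof -
  have nz: "g a \<noteq> 0" if "a \<in> A" for a
    using assms(3)[OF that] by auto
  have "multiplicity p (prod g A) = (\<Sum>a\<in>A. multiplicity p (g a))"
    using assms nz by (intro prime_elem_multiplicity_prod_distrib) auto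
  also have "\<dots> \<le> (\<Sum>a\<in>A. s)"
  proof (rule sum_mono)
    fix a assume "a \<in> A"
    then show "multiplicity p (g a) \<le> s"
      using assms(3) multiplicity_dvd' not_less_eq_eq by blast
  qed
  finally show ?thesis by simp
qed

lemma sum_atMost_choose_two: "(\<Sum>j\<le>k. j) = Suc k choose 2"
  by (induction k) (simp_all add: numeral_2_eq_2)

text \<open>If \<open>k + 1\<close> roots are distinct modulo \<open>p ^ Suc s\<close>, each of
  their differences has \<open>p\<close>-adic valuation at most \<open>s\<close>, so the Vandermonde
  product has valuation at most \<open>(Suc k choose 2) * s < m\<close>. But \<open>p ^ m\<close>
  divides that product, because the top coefficient is a unit modulo \<open>p\<close>.\<close>

lemma card_roots_mod_prime_power_le:
  fixes f :: "int poly" and p :: int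
  assumes "degree f \<le> k" "prime p" "\<not> p dvd coeff f k" "(Suc k choose 2) * s < m"
  shows "card ((\<lambda>x. x mod p ^ Suc s) ` {x. p ^ m dvd poly f x}) \<le> k"
proof (rule ccontr)
  let ?W = "(\<lambda>x. x mod p ^ Suc s) ` {x. p ^ m dvd poly f x}"
  assume "\<not> card ?W \<le> k"
  then have "Suc k \<le> card ?W" by simp
  then obtain T where T: "T \<subseteq> ?W" "card T = Suc k" "finite T"
    by (rule obtain_subset_with_card_n)
  then obtain h where h: "bij_betw h {0..<Suc k} T"
    using ex_bij_betw_nat_finite by metis
  have "h j \<in> ?W" if "j \<le> k" for j
    using T(1) bij_betw_apply[OF h, of j] that by auto
  then have "\<forall>j. \<exists>y. j \<le> k \<longrightarrow> p ^ m dvd poly f y \<and> y mod p ^ Suc s = h j"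
    by (simp add: image_iff) metis
  then obtain x where x: "\<And>j. j \<le> k \<Longrightarrow> p ^ m dvd poly f (x j)"
    and xh: "\<And>j. j \<le> k \<Longrightarrow> x j mod p ^ Suc s = h j"
    unfolding choice_iff by blast
  define V where "V = (SIGMA j:{..k}. {..<j})"
  have diff: "\<not> p ^ Suc s dvd x j - x i" if "(j, i) \<in> V" for j i
  proof
    assume "p ^ Suc s dvd x j - x i"
    then have "x j mod p ^ Suc s = x i mod p ^ Suc s"
      by (simp add: mod_eq_dvd_iff)
    then have "h j = h i"
      using that xh[of j] xh[of i] by (simp add: V_def)
    moreover have "inj_on h {0..<Suc k}"
      using h by (simp add: bij_betw_def)
    ultimately show False
      using that inj_onD[of h "{0..<Suc k}" j i] by (auto simp: V_def)
  qed
  have cardV: "card V = Suc k choose 2"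
    by (simp add: V_def sum_atMost_choose_two)
  have prodV: "(\<Prod>j\<le>k. \<Prod>i<j. x j - x i) = (\<Prod>(j, i)\<in>V. x j - x i)"
    unfolding V_def by (rule prod.Sigma) auto
  have "p ^ m dvd coeff f k * (\<Prod>(j, i)\<in>V. x j - x i)"
    using dvd_vandermonde_if_dvd_values[where x = x, OF assms(1) x] unfolding prodV .
  moreover have "coprime (p ^ m) (coeff f k)"
    using assms(2,3) by (simp add: prime_imp_coprime)
  ultimately have "p ^ m dvd (\<Prod>(j, i)\<in>V. x j - x i)"
    by (simp add: coprime_dvd_mult_right_iff)
  \<comment> \<open>By convention \<open>multiplicity p 0 = 0\<close>, so divisibility gives a lower
    bound on the multiplicity only for a nonzero product.\<close>
  moreover have "(\<Prod>(j, i)\<in>V. x j - x i) \<noteq> 0"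
    using diff by (force simp: V_def)
  ultimately have "m \<le> multiplicity p (\<Prod>(j, i)\<in>V. x j - x i)"
    using assms(2) by (intro multiplicity_geI) auto
  also have "\<dots> \<le> card V * s"
    using assms(2) diff by (intro multiplicity_prod_le) (auto simp: V_def)
  finally show False
    using assms(4) cardV by simp
qed

section \<open>Upper roots of a modulus, and residue classes of polynomial roots\<close>

lemma divides_if_prime_powers_dvd:
  fixes z :: int
  assumes "d > 0" "\<And>p. p \<in> prime_factors d \<Longrightarrow> p ^ multiplicity p d dvd z"
  shows "d dvd z"
proof (cases "z = 0")
  case False
  show ?thesis
  proof (rule multiplicity_le_imp_dvd)
    fix p :: int assume p: "prime p"
    show "multiplicity p d \<le> multiplicity p z"
    proof (cases "p dvd d")
      case True
      then have "p ^ multiplicity p d dvd z"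
        using p assms by (simp add: prime_factors_dvd)
      then show ?thesis
        using p False by (intro multiplicity_geI) auto
    qed (simp add: not_dvd_imp_multiplicity_0)
  qed (use assms in auto)
qed simp

lemma int_eqI_multiplicity:
  fixes x y :: int
  assumes "x > 0" "y > 0" "prime_factors x \<subseteq> A" "prime_factors y \<subseteq> A"
    "\<And>p. p \<in> A \<Longrightarrow> multiplicity p x = multiplicity p y"
  shows "x = y"
proof (rule multiplicity_eq_int)
  fix p :: int assume p: "prime p"
  show "multiplicity p x = multiplicity p y"
  proof (cases "p \<in> A")
    case False
    then have "p \<notin> prime_factors x" "p \<notin> prime_factors y"
      using assms by auto
    with p show ?thesis
      by (simp add: prime_factors_multiplicity del: prime_multiplicity_gt_zero_iff)
  qed (use assms in auto)
qed (use assms in auto)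

text \<open>The exponent is \<open>\<lceil>m/b\<rceil>\<close> for \<open>m = multiplicity p n \<ge> 1\<close>.\<close>
definition upper_root :: "nat \<Rightarrow> int \<Rightarrow> int" where
  "upper_root b n = (\<Prod>p\<in>prime_factors n. p ^ Suc ((multiplicity p n - 1) div b))"

lemma multiplicity_upper_root:
  assumes "prime p"
  shows "multiplicity p (upper_root b n) =
    (if p \<in> prime_factors n then Suc ((multiplicity p n - 1) div b) else 0)"
  unfolding upper_root_def using assms
  by (intro multiplicity_prod_prime_powers) auto

lemma upper_root_pos: "upper_root b n > 0"
  unfolding upper_root_def by (intro prod_pos) (simp add: prime_gt_0_int in_prime_factors_imp_prime)

lemma prime_factors_upper_root: "prime_factors (upper_root b n) = prime_factors n"
proof (rule set_eqI)
  fix p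
  show "p \<in> prime_factors (upper_root b n) \<longleftrightarrow> p \<in> prime_factors n"
  proof (cases "prime p")
    case True
    then show ?thesis
      by (simp add: prime_factors_multiplicity[of "upper_root b n"] multiplicity_upper_root
          del: prime_multiplicity_gt_zero_iff)
  qed auto
qed

lemma upper_root_dvd:
  assumes "n \<noteq> 0"
  shows "upper_root b n dvd n"
proof (rule multiplicity_le_imp_dvd)
  fix p :: int assume p: "prime p"
  have "Suc ((multiplicity p n - 1) div b) \<le> multiplicity p n" if "p \<in> prime_factors n"
  proof -
    have "multiplicity p n > 0" using that by (simp add: prime_factors_multiplicity)
    moreover have "(multiplicity p n - 1) div b \<le> multiplicity p n - 1"
      by (rule div_le_dividend)
    ultimately show ?thesis by linarith
  qed
  then show "multiplicity p (upper_root b n) \<le> multiplicity p n"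
    using p by (simp add: multiplicity_upper_root)
qed (use upper_root_pos[of b n] in auto)

text \<open>\<open>n\<close> has the same primes as \<open>d\<close>, so its exponents at these
  primes determine it, and each exponent of \<open>d\<close> leaves \<open>b\<close> choices for
  that of \<open>n\<close>.\<close>

lemma card_upper_root_fibre_le:
  assumes "b > 0"
  shows "finite {n. n > 0 \<and> upper_root b n = d}"
    and "card {n. n > 0 \<and> upper_root b n = d} \<le> b ^ omega d"
proof -
  let ?S = "{n. n > 0 \<and> upper_root b n = d}"
  \<comment> \<open>For a prime \<open>p\<close> of \<open>d\<close>, these are the \<open>m\<close>
    with \<open>\<lceil>m/b\<rceil>\<close> equal to the exponent of \<open>p\<close> in
    \<open>d\<close>.\<close>
  define M where "M p = {b * (multiplicity p d - 1)<..b * (multiplicity p d - 1) + b}" for p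
  define g where "g n = restrict (\<lambda>p. multiplicity p n) (prime_factors d)" for n
  have inj: "inj_on g ?S"
  proof (rule inj_onI)
    fix x y assume x: "x \<in> ?S" and y: "y \<in> ?S" and "g x = g y"
    then have eq: "multiplicity p x = multiplicity p y" if "p \<in> prime_factors d" for p
      using that by (metis (mono_tags, lifting) g_def restrict_apply')
    have px: "prime_factors x = prime_factors d" "prime_factors y = prime_factors d"
      using x y prime_factors_upper_root[of b x] prime_factors_upper_root[of b y] by simp_all
    show "x = y"
      by (rule int_eqI_multiplicity[of _ _ "prime_factors d"]) (use x y eq px in auto)
  qed
  have sub: "g ` ?S \<subseteq> (\<Pi>\<^sub>E p\<in>prime_factors d. M p)"
  proof (clarsimp simp: g_def)
    fix n p assume n: "n > 0" "d = upper_root b n" and p: "p \<in> prime_factors (upper_root b n)"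
    then have p': "p \<in> prime_factors n" "prime p" 
      by (auto simp: prime_factors_upper_root)
    define m where "m = multiplicity p n - 1"
    have m: "multiplicity p n = Suc m"
      using p' by (simp add: m_def prime_factors_multiplicity)
    have "multiplicity p d = Suc (m div b)"
      using p' n by (simp add: multiplicity_upper_root m)
    moreover have "b * (m div b) \<le> m" "m < b * (m div b) + b"
      using assms by (simp_all add: dividend_less_times_div add.commute)
    ultimately show "multiplicity p n \<in> M p"
      by (simp add: M_def m less_Suc_eq_le)
  qed
  have fin: "finite (\<Pi>\<^sub>E p\<in>prime_factors d. M p)"
    by (intro finite_PiE) (auto simp: M_def)
  from finite_imageD[OF finite_subset[OF sub fin] inj] show "finite ?S" .
  from card_inj_on_le[OF inj sub fin] show "card ?S \<le> b ^ omega d"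
    by (simp add: card_PiE M_def omega_def)
qed

lemma finite_image_mod: "finite ((\<lambda>x. x mod m) ` A)" if "m > 0" for m :: int
  by (rule finite_subset[of _ "{0..<m}"]) (use that in auto)

text \<open>This rests on the injective half of the Chinese remainder theorem: a class modulo the
  upper root \<open>d\<close> is determined by its residues modulo the prime powers exactly dividing
  \<open>d\<close>, and the prime power case leaves at most \<open>k\<close> residues for
  each.\<close>

lemma card_roots_mod_upper_root_le:
  fixes f :: "int poly" and q :: int
  assumes "degree f \<le> k" "q > 0" "coprime q (coeff f k)"
  shows "card ((\<lambda>x. x mod upper_root (Suc k choose 2) q) ` {x. q dvd poly f x}) \<le> k ^ omega q"
proof -
  define b where "b = Suc k choose 2"
  define d where "d = upper_root b q"
  define t where "t p = multiplicity p d" for p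
  define R where "R p = (\<lambda>x. x mod p ^ t p) ` {x. p ^ multiplicity p q dvd poly f x}" for p
  define g where "g x = restrict (\<lambda>p. x mod p ^ t p) (prime_factors q)" for x :: int
  let ?W = "(\<lambda>x. x mod d) ` {x. q dvd poly f x}"
  have d: "d > 0" by (simp add: d_def upper_root_pos)
  have dq: "prime_factors d = prime_factors q"
    by (simp add: d_def prime_factors_upper_root)
  have inj: "inj_on g ?W"
  proof (rule inj_onI)
    fix x y assume x: "x \<in> ?W" and y: "y \<in> ?W" and "g x = g y"
    then have eq: "x mod p ^ t p = y mod p ^ t p" if "p \<in> prime_factors q" for p
      using that by (metis (mono_tags, lifting) g_def restrict_apply')
    have "d dvd x - y"
      using d by (rule divides_if_prime_powers_dvd)
        (use eq dq in \<open>simp add: t_def mod_eq_dvd_iff\<close>)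
    then have "x mod d = y mod d" by (simp add: mod_eq_dvd_iff)
    then show "x = y" using x y by auto
  qed
  have sub: "g ` ?W \<subseteq> (\<Pi>\<^sub>E p\<in>prime_factors q. R p)"
  proof (clarsimp simp: g_def)
    fix x p assume x: "q dvd poly f x" and p: "p \<in> prime_factors q"
    have "p ^ t p dvd d" unfolding t_def by (rule multiplicity_dvd)
    then have "x mod d mod p ^ t p = x mod p ^ t p" by (rule mod_mod_cancel)
    moreover have "p ^ multiplicity p q dvd poly f x"
      using x multiplicity_dvd dvd_trans by blast
    ultimately show "x mod d mod p ^ t p \<in> R p" by (auto simp: R_def)
  qed
  have R: "finite (R p)" "card (R p) \<le> k" if p: "p \<in> prime_factors q" for p
  proof -
    have pr: "prime p" using p by auto
    then have "p > 0" by (rule prime_gt_0_int)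
    then show "finite (R p)" unfolding R_def by (intro finite_image_mod) simp
    \<comment> \<open>The prime power case asks for \<open>b * s < multiplicity p q\<close>. If
      \<open>b > 0\<close>, the largest such \<open>s\<close> is
      \<open>(multiplicity p q - 1) div b\<close>, which explains the exponent in
      \<open>upper_root\<close>. If \<open>k = 0\<close>, then \<open>b = 0\<close> and
      \<open>div\<close> yields 0, which also satisfies the inequality.\<close>
    have t: "t p = Suc ((multiplicity p q - 1) div b)"
      using p pr by (simp add: t_def d_def multiplicity_upper_root)
    have "multiplicity p q > 0" using p by (simp add: prime_factors_multiplicity)
    moreover have "b * ((multiplicity p q - 1) div b) \<le> multiplicity p q - 1" by simp
    ultimately have lt: "b * ((multiplicity p q - 1) div b) < multiplicity p q" by linarith
    have "\<not> p dvd coeff f k"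
      using assms(3) p pr by (meson coprime_common_divisor in_prime_factors_imp_dvd not_prime_unit)
    from card_roots_mod_prime_power_le[OF assms(1) pr this lt[unfolded b_def]]
    show "card (R p) \<le> k" by (simp add: R_def t b_def)
  qed
  have "card ?W \<le> card (\<Pi>\<^sub>E p\<in>prime_factors q. R p)"
    using inj sub by (rule card_inj_on_le) (use R in \<open>auto intro: finite_PiE\<close>)
  also have "\<dots> = (\<Prod>p\<in>prime_factors q. card (R p))" by (simp add: card_PiE)
  also have "\<dots> \<le> (\<Prod>p\<in>prime_factors q. k)" using R by (intro prod_mono) auto
  finally show ?thesis by (simp add: omega_def d_def b_def)
qed

lemma card_residue_class_interval_le:
  fixes d :: int
  assumes "d > 0"
  shows "real (card {i\<in>{m..<m + int N}. i mod d = r}) \<le> real N / real_of_int d + 1"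
proof -
  define S where "S = {i\<in>{m..<m + int N}. i mod d = r}"
  have fin: "finite S" unfolding S_def by (rule finite_Collect_conjI) simp
  show ?thesis
  proof (cases "S = {}")
    case False
    \<comment> \<open>The members of the class form part of the progression
      \<open>s, s + d, ...\<close> and exceed \<open>s\<close> by at most
      \<open>N - 1\<close>.\<close>
    define s where "s = Min S"
    have s: "s \<in> S" using fin False by (simp add: s_def)
    have "S \<subseteq> (\<lambda>j. s + d * j) ` {0..(int N - 1) div d}"
    proof
      fix i assume i: "i \<in> S"
      then have le: "s \<le> i" using fin by (simp add: s_def)
      have "d dvd i - s" using i s by (simp add: S_def mod_eq_dvd_iff[symmetric])
      then obtain j where j: "i - s = d * j" ..
      have "d * j \<ge> 0" using j le by simp
      then have "j \<ge> 0" using assms by (simp add: zero_le_mult_iff)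
      moreover have "i - s \<le> int N - 1" using i s by (simp add: S_def)
      then have "j \<le> (int N - 1) div d"
        using zdiv_mono1[of "i - s" "int N - 1" d] j assms by simp
      ultimately show "i \<in> (\<lambda>j. s + d * j) ` {0..(int N - 1) div d}"
        using j by (intro image_eqI[of _ _ j]) auto
    qed
    then have "card S \<le> card {0..(int N - 1) div d}"
      by (rule surj_card_le[rotated]) simp
    also have "\<dots> = nat ((int N - 1) div d + 1)" by simp
    finally have c: "card S \<le> nat ((int N - 1) div d + 1)" .
    have "N > 0" using s by (simp add: S_def)
    then have nn: "(int N - 1) div d \<ge> 0" using assms by (simp add: pos_imp_zdiv_nonneg_iff)
    have "real_of_int ((int N - 1) div d) \<le> real_of_int (int N - 1) / real_of_int d"
      by (rule real_of_int_div4)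
    also have "\<dots> \<le> real N / real_of_int d"
      using assms by (intro divide_right_mono) auto
    finally show ?thesis using c nn unfolding S_def[symmetric] by linarith
  next
    case True
    then show ?thesis
      using assms unfolding S_def[symmetric] by simp
  qed
qed

section \<open>Integers composed of prescribed primes\<close>

lemma prime_int_less_8:
  fixes p :: int
  assumes "prime p" "p < 8"
  shows "p \<in> {2, 3, 5, 7}"
proof -
  have "p \<ge> 2" "p > 2 \<longrightarrow> odd p"
    using assms prime_ge_2_int prime_odd_int by auto
  with assms(2) show ?thesis
    by simp presburger
qed

text \<open>The exponents at the primes in \<open>A\<close> determine \<open>q\<close>. The number
  of \<open>e\<close> with \<open>p ^ e \<le> int Q\<close> is at most \<open>log1 Q\<close> times a
  weight that is 3 for four small primes and 1 for all others, whence
  \<open>81 = 3 ^ 4\<close>.\<close>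

lemma card_smooth_int_le:
  assumes "finite A" "\<And>p. p \<in> A \<Longrightarrow> prime p" "Q \<ge> 1"
  shows "real (card {q \<in> {1..int Q}. prime_factors q \<subseteq> A}) \<le> 81 * log1 Q ^ card A"
proof -
  define L where "L = log1 Q"
  have L: "L \<ge> 1" "L \<ge> ln Q" by (simp_all add: L_def log1_def)
  define M where "M p = {e. p ^ e \<le> int Q}" for p :: int
  \<comment> \<open>Primes above \<open>8 > exp 2\<close> contribute a factor at most \<open>L\<close>, so the constant does not depend on \<open>A\<close>.\<close>
  define w where "w p = (if p \<in> {2, 3, 5, 7} then 3 else 1 :: real)" for p :: int
  let ?S = "{q \<in> {1..int Q}. prime_factors q \<subseteq> A}"
  define g where "g n = restrict (\<lambda>p. multiplicity p n) A" for n :: int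
  have M: "finite (M p) \<and> card (M p) \<le> w p * L" if p: "p \<in> A" for p
  proof -
    have pr: "prime p" using assms p by auto
    then have p2: "p \<ge> 2" by (rule prime_ge_2_int)
    then have lnp: "ln p > 0" by simp
    define n where "n = nat \<lfloor>ln Q / ln p\<rfloor>"
    have nn: "ln Q / ln p \<ge> 0" using assms(3) lnp by simp
    have sub: "M p \<subseteq> {..n}"
    proof
      fix e assume "e \<in> M p"
      then have "of_int (p ^ e) \<le> (of_int (int Q) :: real)"
        unfolding M_def mem_Collect_eq of_int_le_iff .
      then have "real_of_int p ^ e \<le> real Q" by simp
      then have "ln (real_of_int p ^ e) \<le> ln Q" using p2 assms(3) by (subst ln_le_cancel_iff) auto
      then have "e * ln p \<le> ln Q" using p2 by (simp add: ln_realpow)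
      then have "e \<le> ln Q / ln p" using lnp by (simp add: field_simps)
      then show "e \<in> {..n}" unfolding n_def by (simp add: le_nat_floor)
    qed
    then have fin: "finite (M p)" by (rule finite_subset) simp
    have "card (M p) \<le> Suc n" using card_mono[OF _ sub] by simp
    then have le: "real (card (M p)) \<le> ln Q / ln p + 1"
      using nn unfolding n_def by linarith
    \<comment> \<open>For \<open>p > Q\<close> the bound \<open>ln Q / ln p + 1\<close> may exceed
      \<open>L\<close>, but 0 is then the only exponent. For \<open>8 \<le> p \<le> Q\<close> the
      summand 1 is at most \<open>ln Q / ln p\<close>, and \<open>ln p \<ge> 2\<close> compensates
      the resulting factor 2.\<close>
    consider "p \<in> {2, 3, 5, 7}" | "int Q < p" | "p \<le> int Q" "p \<ge> 8"
      using prime_int_less_8[OF pr] by linarith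
    then have "real (card (M p)) \<le> w p * L"
    proof cases
      case 1
      \<comment> \<open>The quotient contributes \<open>2 * L\<close> and the summand 1 another
        \<open>L\<close>, which gives the weight 3.\<close>
      have "ln p \<ge> ln 2" using p2 by simp
      then have "ln p \<ge> 1 / 2" using ln2_ge_two_thirds by linarith
      then have "ln Q / ln p \<le> L / (1/2)" using L by (intro frac_le) auto
      then have "ln Q / ln p + 1 \<le> 3 * L" using L by simp
      with le 1 show ?thesis by (simp add: w_def)
    next
      case 2
      have "M p \<subseteq> {0}"
      proof
        fix e assume "e \<in> M p"
        then have "p ^ e < p" using 2 by (simp add: M_def)
        then show "e \<in> {0}" using p2 self_le_power[of p e] by (cases "e = 0") auto
      qed
      then have "card (M p) \<le> 1" using card_mono[of "{0}" "M p"] by simp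
      moreover have "1 \<le> w p" by (simp add: w_def)
      then have "1 * 1 \<le> w p * L" using L by (intro mult_mono) auto
      ultimately show ?thesis by linarith
    next
      case 3
      have "exp 2 \<le> (8::real)"
      proof -
        have "exp (1::real) \<le> 272 / 100" using e_less_272 by simp
        then have "exp 1 ^ 2 \<le> (272 / 100 :: real) ^ 2" by (intro power_mono) auto
        then show ?thesis by (simp add: exp_double[symmetric] power2_eq_square exp_add[symmetric])
      qed
      then have "2 \<le> ln p" using 3 p2 by (subst ln_ge_iff) auto
      have "ln p \<le> ln Q" using 3 p2 by (subst ln_le_cancel_iff) auto
      then have "1 \<le> ln Q / ln p" using lnp by simp
      then have "ln Q / ln p + 1 \<le> 2 * (ln Q / ln p)" by simp
      also have "\<dots> = 2 * ln Q / ln p" by simp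
      also have "\<dots> \<le> 2 * L / 2" using L \<open>2 \<le> ln p\<close> \<open>ln p \<le> ln Q\<close> by (intro frac_le) auto
      finally show ?thesis using le 3 by (simp add: w_def)
    qed
    with fin show ?thesis by simp
  qed
  have inj: "inj_on g ?S"
  proof (rule inj_onI)
    fix x y assume x: "x \<in> ?S" and y: "y \<in> ?S" and "g x = g y"
    then have eq: "multiplicity p x = multiplicity p y" if "p \<in> A" for p
      using that by (metis (mono_tags, lifting) g_def restrict_apply')
    show "x = y"
      by (rule int_eqI_multiplicity[of _ _ A]) (use x y eq in auto)
  qed
  have sub: "g ` ?S \<subseteq> (\<Pi>\<^sub>E p\<in>A. M p)"
  proof (clarsimp simp: g_def M_def)
    fix q p assume q: "1 \<le> q" "q \<le> int Q"
    have "p ^ multiplicity p q \<le> q" using q by (intro zdvd_imp_le multiplicity_dvd) auto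
    with q show "p ^ multiplicity p q \<le> int Q" by simp
  qed
  have "card ?S \<le> card (\<Pi>\<^sub>E p\<in>A. M p)"
    using inj sub by (rule card_inj_on_le) (use M assms in \<open>auto intro: finite_PiE\<close>)
  also have "\<dots> = (\<Prod>p\<in>A. card (M p))" using assms by (simp add: card_PiE)
  finally have "real (card ?S) \<le> (\<Prod>p\<in>A. real (card (M p)))"
    by (metis of_nat_le_iff of_nat_prod)
  also have "\<dots> \<le> (\<Prod>p\<in>A. w p * L)" using M by (intro prod_mono) auto
  also have "\<dots> = (\<Prod>p\<in>A. w p) * L ^ card A" by (simp add: prod.distrib)
  also have "(\<Prod>p\<in>A. w p) = (\<Prod>p\<in>A \<inter> {2,3,5,7}. 3)"
    unfolding w_def using assms(1) by (rule prod.inter_restrict[symmetric])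
  also have "\<dots> \<le> 3 ^ card {2,3,5,7::int}"
    unfolding prod_constant by (intro power_increasing card_mono) auto
  finally show ?thesis using L by (simp add: L_def mult_right_mono)
qed

section \<open>Sums of \<open>t ^ omega d / d\<close> and the harmonic sum\<close>

text \<open>Expanding the product of \<open>t + 1\<close> over the primes of \<open>d\<close> gives
  a term \<open>t ^ card X\<close> for each set \<open>X\<close> of these primes, hence for each
  squarefree divisor \<open>\<Prod>X\<close>. Other divisors only add nonnegative terms.\<close>

lemma power_omega_le_sum_divisors:
  assumes "d \<ge> 1" "d \<le> int Q"
  shows "(1 + real t) ^ omega d \<le> (\<Sum>a | a \<in> {1..int Q} \<and> a dvd d. real t ^ omega a)"
proof -
  have fin: "finite {a. a \<in> {1..int Q} \<and> a dvd d}"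
    by (rule finite_Collect_conjI) simp
  have "(1 + real t) ^ omega d = (\<Prod>p\<in>prime_factors d. real t + 1)"
    by (simp add: omega_def add.commute)
  also have "\<dots> = (\<Sum>X\<in>Pow (prime_factors d). real t ^ card X)"
    by (subst prod_add) auto
  also have "\<dots> \<le> (\<Sum>a | a \<in> {1..int Q} \<and> a dvd d. real t ^ omega a)"
  proof (rule sum_le_included[where i = prime_factors])
    show "\<forall>X\<in>Pow (prime_factors d). \<exists>a\<in>{a. a \<in> {1..int Q} \<and> a dvd d}.
        prime_factors a = X \<and> real t ^ card X \<le> real t ^ omega a"
    proof safe
      fix X assume X: "X \<subseteq> prime_factors d"
      define a where "a = \<Prod>X"
      have fin: "finite X" using X by (rule finite_subset) simp
      have pr: "\<And>p. p \<in> X \<Longrightarrow> prime p" using X by auto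
      have mult: "multiplicity p a = (if p \<in> X then 1 else 0)" if "prime p" for p
        using multiplicity_prod_prime_powers[of X p "\<lambda>_. 1"] fin pr that by (simp add: a_def)
      have pf: "prime_factors a = X"
        using pr by (auto simp: prime_factors_multiplicity mult simp del: prime_multiplicity_gt_zero_iff split: if_splits)
      have "a > 0" unfolding a_def by (intro prod_pos) (simp add: pr prime_gt_0_int)
      moreover have "a dvd d"
      proof (rule multiplicity_le_imp_dvd)
        fix p :: int assume "prime p"
        then show "multiplicity p a \<le> multiplicity p d"
          using X by (auto simp: mult prime_factors_multiplicity Suc_le_eq simp del: prime_multiplicity_gt_zero_iff)
      qed (use \<open>a > 0\<close> in auto)
      moreover have "a \<le> d" using \<open>a dvd d\<close> assms by (intro zdvd_imp_le) auto
      ultimately show "\<exists>a\<in>{a. a \<in> {1..int Q} \<and> a dvd d}.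
        prime_factors a = X \<and> real t ^ card X \<le> real t ^ omega a"
        using pf assms by (intro bexI[of _ a]) (auto simp: omega_def)
    qed
  qed (use fin in auto)
  finally show ?thesis .
qed

text \<open>Induction on \<open>t\<close>: expanding \<open>(t + 1) ^ omega d\<close> over divisors
  \<open>a\<close> of \<open>d = a * b\<close> bounds the sum by a product of the harmonic sum over
  \<open>b\<close> and the sum for \<open>t\<close> over \<open>a\<close>.\<close>

lemma sum_power_omega_div_le:
  "(\<Sum>d=1..int Q. real t ^ omega d / d) \<le> (\<Sum>n=1..int Q. 1 / n) ^ t"
proof (induction t)
  case 0
  \<comment> \<open>Since \<open>0 ^ 0 = 1\<close>, the term \<open>d = 1\<close> survives, and it
    alone.\<close>
  have "(\<Sum>d=1..int Q. 0 ^ omega d / real_of_int d) \<le> (\<Sum>d=1..int Q. if d = 1 then 1 else 0)"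
  proof (rule sum_mono)
    fix d assume d: "d \<in> {1..int Q}"
    have "omega d \<noteq> 0" if "d \<noteq> 1"
      using d that by (simp add: omega_def prime_factorization_empty_iff)
    then show "0 ^ omega d / real_of_int d \<le> (if d = 1 then 1 else 0)"
      by (auto simp: power_0_left)
  qed
  also have "\<dots> \<le> 1" by (simp add: sum.delta)
  finally show ?case by simp
next
  case (Suc t)
  let ?D = "{1..int Q}"
  have "(\<Sum>d\<in>?D. real (Suc t) ^ omega d / d)
      \<le> (\<Sum>d\<in>?D. \<Sum>a | a \<in> ?D \<and> a dvd d. real t ^ omega a / d)"
  proof (rule sum_mono)
    fix d assume "d \<in> ?D"
    then show "real (Suc t) ^ omega d / d \<le> (\<Sum>a | a \<in> ?D \<and> a dvd d. real t ^ omega a / d)"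
      using power_omega_le_sum_divisors[of d Q t]
      by (simp add: sum_divide_distrib[symmetric] divide_right_mono)
  qed
  also have "\<dots> = (\<Sum>(d, a)\<in>(SIGMA d:?D. {a. a \<in> ?D \<and> a dvd d}). real t ^ omega a / d)"
    by (rule sum.Sigma) auto
  also have "\<dots> \<le> (\<Sum>(b, a)\<in>?D \<times> ?D. (1 / real_of_int b) * (real t ^ omega a / a))"
  \<comment> \<open>Admitting the pairs with \<open>a * b > Q\<close> as well makes the double sum
    factor.\<close>
  proof (rule sum_le_included[where i = "\<lambda>(b, a). (a * b, a)"])
    show "\<forall>x\<in>SIGMA d:?D. {a. a \<in> ?D \<and> a dvd d}. \<exists>y\<in>?D \<times> ?D. (case y of (b, a) \<Rightarrow> (a * b, a)) = x \<and>
      (case x of (d, a) \<Rightarrow> real t ^ omega a / d) \<le> (case y of (b, a) \<Rightarrow> 1 / real_of_int b * (real t ^ omega a / a))"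
    proof clarsimp
      fix d a assume d: "1 \<le> d" "d \<le> int Q" and a: "1 \<le> a" "a \<le> int Q" and "a dvd d"
      then obtain b where b: "d = a * b" by auto
      have "b \<ge> 1" using d a b by (metis int_one_le_iff_zero_less zero_less_mult_pos)
      moreover from this have "1 * b \<le> a * b"
        using a by (intro mult_right_mono) auto
      then have "b \<le> int Q"
        using b d by linarith
      ultimately show "\<exists>aa\<in>{1..int Q}. a * aa = d \<and> real t ^ omega a / real_of_int d \<le> real t ^ omega a / (real_of_int aa * real_of_int a)"
        using d b by (intro bexI[of _ b]) (auto simp: mult.commute)
    qed
  qed auto
  also have "\<dots> = (\<Sum>b\<in>?D. 1 / real_of_int b) * (\<Sum>a\<in>?D. real t ^ omega a / a)"
    by (simp add: sum_product sum.cartesian_product)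
  also have "\<dots> \<le> (\<Sum>b\<in>?D. 1 / real_of_int b) * (\<Sum>n\<in>?D. 1 / real_of_int n) ^ t"
    using Suc.IH by (intro mult_left_mono sum_nonneg) auto
  finally show ?case by simp
qed

lemma sum_inverse_le_log1:
  assumes "Q \<ge> 1"
  shows "(\<Sum>n=1..int Q. 1 / real_of_int n) \<le> 2 * log1 Q"
proof -
  have "(\<Sum>n=1..int Q. 1 / real_of_int n) = harm Q"
    unfolding harm_def
    by (rule sum.reindex_bij_witness[of _ int nat]) (auto simp: field_simps)
  also obtain m where m: "Q = Suc m" using assms by (cases Q) auto
  \<comment> \<open>The difference \<open>harm n - ln n\<close> decreases from 1 at
    \<open>n = 1\<close>. Both 1 and \<open>ln Q\<close> are at most \<open>log1 Q\<close>, hence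
    the factor 2.\<close>
  have "harm Q - ln (real Q) \<le> harm (Suc 0) - ln (real (Suc 0))"
    using decseqD[OF decseq_harm_diff_ln, of 0 m] m by simp
  then have "harm Q \<le> 1 + ln Q" by (simp add: harm_def)
  also have "\<dots> \<le> 2 * log1 Q" by (simp add: log1_def)
  finally show ?thesis .
qed

section \<open>Divisibility of polynomial values on an interval\<close>

text \<open>Roots are sorted by class modulo the upper root of \<open>q\<close>, because modulo
  \<open>q\<close> itself they may fill many more than \<open>k ^ omega q\<close> classes.\<close>

lemma card_roots_interval_le:
  fixes f :: "int poly" and q :: int
  assumes "degree f \<le> k" "q > 0" "coprime q (coeff f k)"
  shows "real (card {i\<in>{m..<m + int N}. q dvd poly f i})
    \<le> real k ^ omega q * (real N / real_of_int (upper_root (Suc k choose 2) q) + 1)"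
proof -
  define d where "d = upper_root (Suc k choose 2) q"
  have d: "d > 0" by (simp add: d_def upper_root_pos)
  let ?I = "{m..<m + int N}"
  define R where "R = (\<lambda>x. x mod d) ` {x. q dvd poly f x}"
  have fin: "finite R" unfolding R_def using d by (rule finite_image_mod)
  have "{i\<in>?I. q dvd poly f i} \<subseteq> (\<Union>r\<in>R. {i\<in>?I. i mod d = r})"
    by (auto simp: R_def)
  then have "card {i\<in>?I. q dvd poly f i} \<le> card (\<Union>r\<in>R. {i\<in>?I. i mod d = r})"
    by (rule card_mono[rotated]) (intro finite_UN_I fin finite_Collect_conjI, simp)
  also have "\<dots> \<le> (\<Sum>r\<in>R. card {i\<in>?I. i mod d = r})"
    using fin by (rule card_UN_le)
  finally have "real (card {i\<in>?I. q dvd poly f i}) \<le> (\<Sum>r\<in>R. real (card {i\<in>?I. i mod d = r}))"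
    unfolding of_nat_sum[symmetric] by (rule of_nat_mono)
  also have "\<dots> \<le> (\<Sum>r\<in>R. real N / d + 1)"
    using d by (intro sum_mono card_residue_class_interval_le)
  also have "\<dots> = real (card R) * (real N / d + 1)" by simp
  also have "\<dots> \<le> real (k ^ omega q) * (real N / d + 1)"
    using card_roots_mod_upper_root_le[OF assms] d
    by (intro mult_right_mono) (simp_all add: R_def d_def)
  finally show ?thesis by (simp add: d_def)
qed

text \<open>Group the \<open>q\<close> by \<open>d = upper_root b q\<close>, a divisor of
  \<open>q\<close> with the same primes. The fibre size, at most \<open>b ^ omega d\<close>, merges
  with \<open>k ^ omega d\<close>.\<close>

lemma sum_power_omega_div_upper_root_le:
  assumes "b > 0"
  shows "(\<Sum>q=1..int Q. real k ^ omega q / upper_root b q)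
    \<le> (\<Sum>d=1..int Q. real (k * b) ^ omega d / d)"
proof -
  let ?D = "{1..int Q}"
  have img: "upper_root b ` ?D \<subseteq> ?D"
  proof
    fix d assume "d \<in> upper_root b ` ?D"
    then obtain q where q: "q \<in> ?D" "d = upper_root b q" by auto
    then have "d dvd q" by (simp add: upper_root_dvd)
    then have "d \<le> q" using q by (intro zdvd_imp_le) auto
    then show "d \<in> ?D" using q upper_root_pos[of b q] by simp
  qed
  have "(\<Sum>q\<in>?D. real k ^ omega q / upper_root b q)
      = (\<Sum>d\<in>?D. \<Sum>q | q \<in> ?D \<and> upper_root b q = d. real k ^ omega q / upper_root b q)"
    using img by (intro sum.group[symmetric]) auto
  also have "\<dots> \<le> (\<Sum>d\<in>?D. real (k * b) ^ omega d / d)"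
  proof (rule sum_mono)
    fix d assume d: "d \<in> ?D"
    let ?F = "{q. q \<in> ?D \<and> upper_root b q = d}"
    have "card ?F \<le> card {n. n > 0 \<and> upper_root b n = d}"
      by (rule card_mono) (use card_upper_root_fibre_le[OF assms] in auto)
    also have "\<dots> \<le> b ^ omega d" using assms by (rule card_upper_root_fibre_le)
    finally have c: "real (card ?F) \<le> real b ^ omega d" by (metis of_nat_le_iff of_nat_power)
    have "(\<Sum>q\<in>?F. real k ^ omega q / upper_root b q) = (\<Sum>q\<in>?F. real k ^ omega d / d)"
      by (intro sum.cong) (auto simp: omega_def prime_factors_upper_root)
    also have "\<dots> = real (card ?F) * (real k ^ omega d / d)" by simp
    also have "\<dots> \<le> real b ^ omega d * (real k ^ omega d / d)"
      using c d by (intro mult_right_mono) auto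
    finally show "(\<Sum>q\<in>?F. real k ^ omega q / upper_root b q) \<le> real (k * b) ^ omega d / d"
      by (simp add: power_mult_distrib mult.commute)
  qed
  finally show ?thesis .
qed

text \<open>This isolates the part of \<open>q\<close> made of primes of the leading coefficient,
  where the root count does not apply.\<close>

lemma split_along_primes:
  fixes q :: int
  assumes "q > 0"
  obtains q1 q2 where "q = q1 * q2" "q1 > 0" "q2 > 0"
    "prime_factors q1 \<subseteq> A" "prime_factors q2 \<inter> A = {}"
proof -
  define h where "h S = (\<Prod>p\<in>S. p ^ multiplicity p q)" for S :: "int set"
  have pf: "prime_factors (h S) \<subseteq> S" and pos: "h S > 0" if S: "S \<subseteq> prime_factors q" for S
  proof -
    have pr: "finite S" "\<And>p. p \<in> S \<Longrightarrow> prime p"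
      using S finite_subset[OF S] by auto
    then show "prime_factors (h S) \<subseteq> S"
      by (auto simp: prime_factors_multiplicity h_def multiplicity_prod_prime_powers
          simp del: prime_multiplicity_gt_zero_iff split: if_splits)
    show "h S > 0"
      unfolding h_def using pr by (intro prod_pos) (simp add: prime_gt_0_int)
  qed
  have "q = h (prime_factors q)"
    using assms by (simp add: h_def prod_prime_factors)
  also have "\<dots> = h (prime_factors q \<inter> A) * h (prime_factors q - A)"
    unfolding h_def by (rule prod.Int_Diff) simp
  finally show ?thesis
    using pf[of "prime_factors q \<inter> A"] pf[of "prime_factors q - A"] pos
    by (intro that[of "h (prime_factors q \<inter> A)" "h (prime_factors q - A)"]) auto
qed

lemma coprime_if_prime_factors_disjoint:
  fixes a b :: int
  assumes "b \<noteq> 0" "a \<noteq> 0" "prime_factors a \<inter> prime_factors b = {}"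
  shows "coprime a b"
proof (rule ccontr)
  assume "\<not> coprime a b"
  then have "\<not> is_unit (gcd a b)" by (simp add: coprime_iff_gcd_eq_1)
  then obtain p where p: "prime p" "p dvd gcd a b"
    using assms by (metis gcd_eq_0_iff prime_divisorE)
  then have "p \<in> prime_factors a \<inter> prime_factors b"
    using assms(1,2) by (simp add: prime_factors_dvd)
  with assms show False by blast
qed

text \<open>Divisibility by \<open>q = q1 * q2\<close> is relaxed to divisibility by
  \<open>q2\<close>, so \<open>q1\<close> enters only through the number of its values, which yields
  81 and the exponent \<open>omega (lead_coeff f)\<close>. The sum over \<open>q2\<close> yields
  \<open>(2 * log1 Q) ^ theta k\<close>.\<close>

lemma sum_card_dvd_le:
  fixes f :: "int poly"
  assumes "k \<ge> 1" "degree f = k" "Q \<ge> 1"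
  shows "(\<Sum>q=1..int Q. real (card {i\<in>{m..<m + int N}. q dvd poly f i}))
    \<le> 81 * 2 ^ theta k * (real N + real Q) * log1 Q ^ (omega (lead_coeff f) + theta k)"
proof -
  let ?D = "{1..int Q}" and ?I = "{m..<m + int N}"
  define c where "c = lead_coeff f"
  define A where "A = prime_factors c"
  define b where "b = Suc k choose 2"
  have b: "b > 0" using assms by (simp add: b_def)
  have c: "c \<noteq> 0" using assms by (auto simp: c_def)
  define X where "X = {q\<in>?D. prime_factors q \<subseteq> A}"
  \<comment> \<open>This majorizes the root count \<open>k ^ omega q * (N / d + 1)\<close> for
    \<open>d = upper_root b q\<close>: since \<open>d \<le> Q\<close>, the summand 1 is at most
    \<open>Q / d\<close>.\<close>
  define g where "g q = (real N + real Q) * (real k ^ omega q / upper_root b q)" for q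
  have finI: "finite {i\<in>?I. R i}" for R by (rule finite_Collect_conjI) simp
  have fX: "finite X" unfolding X_def by (rule finite_subset[of _ ?D]) auto
  have g0: "g q \<ge> 0" for q using upper_root_pos[of b q] by (simp add: g_def)
  have s0: "0 \<le> (\<Sum>q\<in>?D. real k ^ omega q / upper_root b q)"
    using upper_root_pos[of b] by (intro sum_nonneg divide_nonneg_nonneg) (auto intro: less_imp_le)
  \<comment> \<open>Every \<open>q\<close> is the product of some pair on the right; the pairs with
    product above \<open>Q\<close> only enlarge a sum that then factors.\<close>
  have "(\<Sum>q\<in>?D. real (card {i\<in>?I. q dvd poly f i})) \<le> (\<Sum>(q1, q2)\<in>X \<times> ?D. g q2)"
  proof (rule sum_le_included[where i = "\<lambda>(q1, q2). q1 * q2"])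
    show "\<forall>q\<in>?D. \<exists>y\<in>X \<times> ?D. (case y of (q1, q2) \<Rightarrow> q1 * q2) = q \<and>
      real (card {i\<in>?I. q dvd poly f i}) \<le> (case y of (q1, q2) \<Rightarrow> g q2)"
    proof
      fix q assume q: "q \<in> ?D"
      then have "q > 0" by simp
      then obtain q1 q2 where q12: "q = q1 * q2" "q1 > 0" "q2 > 0"
        "prime_factors q1 \<subseteq> A" "prime_factors q2 \<inter> A = {}"
        by (rule split_along_primes)
      have "q1 \<le> q" "q2 \<le> q" using q12(1) \<open>q > 0\<close> by (simp_all add: zdvd_imp_le)
      then have "q1 \<le> int Q" "q2 \<le> int Q" using q by simp_all
      then have mem: "(q1, q2) \<in> X \<times> ?D" using q12 by (auto simp: X_def)
      define d where "d = upper_root b q2"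
      have "coprime q2 (coeff f k)"
        using q12 c assms(2) unfolding A_def c_def
        by (intro coprime_if_prime_factors_disjoint) auto
      then have le: "real (card {i\<in>?I. q2 dvd poly f i}) \<le> real k ^ omega q2 * (real N / d + 1)"
        unfolding d_def b_def using assms(2) q12 by (intro card_roots_interval_le) auto
      have d: "d > 0" by (simp add: d_def upper_root_pos)
      have "d dvd q2" using q12 by (simp add: d_def upper_root_dvd)
      then have "d \<le> q2" using q12 by (intro zdvd_imp_le)
      then have "d \<le> int Q" using mem by simp
      then have "1 \<le> real Q / d" using d by simp
      then have "real N / d + 1 \<le> (real N + real Q) / d" by (simp add: add_divide_distrib)
      then have "real k ^ omega q2 * (real N / d + 1) \<le> real k ^ omega q2 * ((real N + real Q) / d)"
        by (intro mult_left_mono) auto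
      also have "\<dots> = g q2" by (simp add: g_def d_def)
      finally have "real (card {i\<in>?I. q2 dvd poly f i}) \<le> g q2" using le by linarith
      moreover have "card {i\<in>?I. q dvd poly f i} \<le> card {i\<in>?I. q2 dvd poly f i}"
        using q12(1) by (intro card_mono finI) (auto intro: dvd_mult_right)
      ultimately show "\<exists>y\<in>X \<times> ?D. (case y of (q1, q2) \<Rightarrow> q1 * q2) = q \<and>
          real (card {i\<in>?I. q dvd poly f i}) \<le> (case y of (q1, q2) \<Rightarrow> g q2)"
        using mem q12 by (intro bexI[of _ "(q1, q2)"]) auto
    qed
  qed (use fX g0 in auto)
  also have "\<dots> = card X * (\<Sum>q\<in>?D. g q)"
    by (simp add: sum.cartesian_product[symmetric])
  also have "(\<Sum>q\<in>?D. g q) = (real N + real Q) * (\<Sum>q\<in>?D. real k ^ omega q / upper_root b q)"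
    by (simp add: g_def sum_distrib_left)
  also have "real (card X) * \<dots>
      \<le> (81 * log1 Q ^ card A) * ((real N + real Q) * (2 * log1 Q) ^ theta k)"
  proof (intro mult_mono mult_left_mono)
    show "real (card X) \<le> 81 * log1 Q ^ card A"
      unfolding X_def by (rule card_smooth_int_le) (use assms in \<open>auto simp: A_def\<close>)
    have "(\<Sum>q\<in>?D. real k ^ omega q / upper_root b q) \<le> (\<Sum>d\<in>?D. real (k * b) ^ omega d / d)"
      using b by (rule sum_power_omega_div_upper_root_le)
    also have "\<dots> \<le> (\<Sum>n\<in>?D. 1 / real_of_int n) ^ (k * b)"
      by (rule sum_power_omega_div_le)
    also have "\<dots> \<le> (2 * log1 Q) ^ (k * b)"
      using assms by (intro power_mono sum_inverse_le_log1 sum_nonneg) auto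
    finally show "(\<Sum>q\<in>?D. real k ^ omega q / upper_root b q) \<le> (2 * log1 Q) ^ theta k"
      by (simp add: theta_def b_def)
  qed (use s0 in \<open>auto simp: log1_def\<close>)
  finally show ?thesis
    by (simp add: A_def c_def omega_def power_add power_mult_distrib mult_ac)
qed

section \<open>Additive characters modulo \<open>q\<close> and their orthogonality\<close>

lemma e_add: "e (x + y) = e x * e y"
  by (simp add: e_def distrib_left exp_add)

lemma e_of_int: "e (of_int n) = 1"
  using exp_integer_2pi[of "of_int n"] by (simp add: e_def mult_ac)

lemma cnj_e_of_real: "cnj (e (of_real x)) = e (- of_real x)"
  by (simp add: e_def exp_cnj)

lemma e_of_nat_mult: "e (of_nat n * z) = e z ^ n"
  by (simp add: e_def exp_of_nat_mult[symmetric] mult_ac)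

lemma e_eq_1_iff_dvd:
  assumes "q > 0"
  shows "e (of_int n / of_int q) = 1 \<longleftrightarrow> q dvd n"
proof
  assume "q dvd n"
  then show "e (of_int n / of_int q) = 1"
    using assms by (auto simp: e_of_int)
next
  assume "e (of_int n / of_int q) = 1"
  then have "\<exists>k::int. 2 * pi * (of_int n / of_int q) = of_int (2 * k) * pi"
    by (simp add: e_def exp_eq_1 Re_divide_of_real del: of_int_mult) 
  then obtain k :: int where "2 * pi * (of_int n / of_int q) = of_int (2 * k) * pi" ..
  then have "(of_int n :: real) / of_int q = of_int k"
    by (simp del: times_divide_eq_right)
  then have "real_of_int n = real_of_int (k * q)" using assms by (simp add: field_simps)
  then have "n = k * q" by (simp only: of_int_eq_iff)
  then show "q dvd n" by simp
qed

lemma sum_e_residues: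
  assumes "q > 0"
  shows "(\<Sum>r=0..<q. e (of_int r * of_int n / of_int q)) = (if q dvd n then of_int q else 0)"
proof -
  define z where "z = e (of_int n / of_int q)"
  have "(\<Sum>r=0..<q. e (of_int r * of_int n / of_int q)) = (\<Sum>r<nat q. z ^ r)"
    by (rule sum.reindex_bij_witness[of _ int nat])
       (use assms in \<open>auto simp: z_def e_of_nat_mult[symmetric]\<close>)
  also have "\<dots> = (if z = 1 then of_nat (nat q) else (1 - z ^ nat q) / (1 - z))"
    by (rule sum_gp_strict)
  \<comment> \<open>As \<open>z\<close> is a \<open>q\<close>-th root of unity, the geometric sum
    vanishes unless \<open>z = 1\<close>.\<close>
  also have "z ^ nat q = 1"
    using assms e_of_int[of n] by (simp add: z_def e_of_nat_mult[symmetric])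
  finally show ?thesis
    using assms e_eq_1_iff_dvd[OF assms, of n] by (auto simp: z_def)
qed

text \<open>Expand the square and sum over \<open>r\<close> first: orthogonality keeps the pairs
  \<open>i, j\<close> with \<open>u i\<close> and \<open>u j\<close> congruent modulo
  \<open>q\<close>, each with weight \<open>q\<close>. The products of coefficients are then bounded
  by squares.\<close>

lemma sum_residues_square_le:
  fixes a :: "int \<Rightarrow> complex" and u :: "int \<Rightarrow> int"
  assumes "finite I" "q > 0"
  shows "(\<Sum>r=0..<q. (cmod (\<Sum>i\<in>I. a i * e (of_int r / of_int q * of_int (u i))))\<^sup>2)
    \<le> of_int q * (\<Sum>i\<in>I. (cmod (a i))\<^sup>2 * real (card {j\<in>I. q dvd u j - u i}))"
proof -
  define S where "S r = (\<Sum>i\<in>I. a i * e (of_int r / of_int q * of_int (u i)))" for r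
  have sq: "of_real ((cmod (S r))\<^sup>2)
      = (\<Sum>i\<in>I. \<Sum>j\<in>I. a i * cnj (a j) * e (of_int r * of_int (u i - u j) / of_int q))" for r
  proof -
    have "cnj (e (of_int r / of_int q * of_int (u j))) = e (- (of_int r / of_int q * of_int (u j)))" for j
      using cnj_e_of_real[of "of_int r / of_int q * of_int (u j)"] by simp
    then have *: "e (of_int r / of_int q * of_int (u i)) * cnj (e (of_int r / of_int q * of_int (u j)))
        = e (of_int r * of_int (u i - u j) / of_int q)" for i j
      by (simp add: e_add[symmetric] ring_distribs diff_divide_distrib)
    have "of_real ((cmod (S r))\<^sup>2) = S r * cnj (S r)" by (rule complex_norm_square)
    also have "\<dots> = (\<Sum>i\<in>I. \<Sum>j\<in>I. a i * cnj (a j) * (e (of_int r / of_int q * of_int (u i)) * cnj (e (of_int r / of_int q * of_int (u j)))))"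
      by (simp add: S_def sum_product mult_ac)
    finally show ?thesis unfolding * .
  qed
  have "complex_of_real (\<Sum>r=0..<q. (cmod (S r))\<^sup>2)
      = (\<Sum>r=0..<q. \<Sum>i\<in>I. \<Sum>j\<in>I. a i * cnj (a j) * e (of_int r * of_int (u i - u j) / of_int q))"
    unfolding of_real_sum sq ..
  also have "\<dots> = (\<Sum>i\<in>I. \<Sum>j\<in>I. \<Sum>r=0..<q. a i * cnj (a j) * e (of_int r * of_int (u i - u j) / of_int q))"
    by (subst sum.swap, rule sum.cong[OF refl], subst sum.swap, rule refl)
  also have "\<dots> = (\<Sum>i\<in>I. \<Sum>j\<in>I. if q dvd u i - u j then a i * cnj (a j) * of_int q else 0)"
    unfolding sum_distrib_left[symmetric] sum_e_residues[OF assms(2)] by (intro sum.cong) auto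
  finally have eq: "complex_of_real (\<Sum>r=0..<q. (cmod (S r))\<^sup>2) = \<dots>" .
  \<comment> \<open>Half the weight \<open>q\<close> goes to each of the two squares bounding a
    product. As \<open>T\<close> is symmetric, the two resulting double sums agree and the halves
    add up to \<open>q\<close>.\<close>
  define T where "T i j = (if q dvd u i - u j then of_int q / 2 else 0 :: real)" for i j
  have T_sum: "(\<Sum>j\<in>I. T j i) = of_int q / 2 * real (card {j\<in>I. q dvd u j - u i})" for i
    using assms by (simp add: T_def sum.inter_filter[symmetric])
  \<comment> \<open>The sum is real and nonnegative, so it equals its modulus and the triangle
    inequality applies to the complex expansion.\<close>
  have "(\<Sum>r=0..<q. (cmod (S r))\<^sup>2) = cmod (complex_of_real (\<Sum>r=0..<q. (cmod (S r))\<^sup>2))"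
    by (simp only: norm_of_real) (simp add: sum_nonneg)
  also have "\<dots> \<le> (\<Sum>i\<in>I. \<Sum>j\<in>I. cmod (if q dvd u i - u j then a i * cnj (a j) * of_int q else 0))"
    unfolding eq by (intro order_trans[OF norm_sum] sum_mono norm_sum)
  also have "\<dots> \<le> (\<Sum>i\<in>I. \<Sum>j\<in>I. T i j * (cmod (a i))\<^sup>2 + T i j * (cmod (a j))\<^sup>2)"
  proof (intro sum_mono)
    fix i j
    have "2 * (cmod (a i) * cmod (a j)) \<le> (cmod (a i))\<^sup>2 + (cmod (a j))\<^sup>2"
      using sum_squares_bound[of "cmod (a i)" "cmod (a j)"] by simp
    then have "of_int q / 2 * (2 * (cmod (a i) * cmod (a j))) \<le> of_int q / 2 * ((cmod (a i))\<^sup>2 + (cmod (a j))\<^sup>2)"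
      using assms by (intro mult_left_mono) auto
    then show "cmod (if q dvd u i - u j then a i * cnj (a j) * of_int q else 0) \<le> T i j * (cmod (a i))\<^sup>2 + T i j * (cmod (a j))\<^sup>2"
      using assms by (auto simp: T_def norm_mult ring_distribs mult_ac)
  qed
  also have "\<dots> = (\<Sum>i\<in>I. \<Sum>j\<in>I. T i j * (cmod (a i))\<^sup>2) + (\<Sum>i\<in>I. \<Sum>j\<in>I. T i j * (cmod (a j))\<^sup>2)"
    by (simp add: sum.distrib)
  also have "(\<Sum>i\<in>I. \<Sum>j\<in>I. T i j * (cmod (a j))\<^sup>2) = (\<Sum>i\<in>I. \<Sum>j\<in>I. T j i * (cmod (a i))\<^sup>2)"
    by (rule sum.swap)
  also have "(\<Sum>i\<in>I. \<Sum>j\<in>I. T i j * (cmod (a i))\<^sup>2) = (\<Sum>i\<in>I. \<Sum>j\<in>I. T j i * (cmod (a i))\<^sup>2)"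
    by (simp add: T_def dvd_diff_commute)
  also have "\<dots> + \<dots> = 2 * (\<Sum>i\<in>I. (cmod (a i))\<^sup>2 * (\<Sum>j\<in>I. T j i))"
    by (simp add: sum_distrib_left sum_distrib_right mult_ac)
  finally show ?thesis
    by (simp add: T_sum S_def sum_distrib_left mult_ac)
qed

section \<open>Sums over Farey fractions\<close>

text \<open>Each Farey fraction occurs as some \<open>r / q\<close>; the fractions not in lowest
  terms repeat values, at a nonnegative cost.\<close>

lemma sum_farey_le:
  fixes F :: "rat \<Rightarrow> real"
  assumes "\<And>x. F x \<ge> 0"
  shows "(\<Sum>x\<in>farey Q. F x) \<le> (\<Sum>q=1..int Q. \<Sum>r=0..<q. F (of_int r / of_int q))"
proof -
  have "(\<Sum>x\<in>farey Q. F x) \<le> (\<Sum>(q, r)\<in>(SIGMA q:{1..int Q}. {0..<q}). F (of_int r / of_int q))"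
    by (rule sum_le_included[where i = "\<lambda>(q, r). of_int r / of_int q"])
       (use assms finite_farey in \<open>auto simp: farey_def image_iff Bex_def\<close>)
  also have "\<dots> = (\<Sum>q=1..int Q. \<Sum>r=0..<q. F (of_int r / of_int q))"
    by (rule sum.Sigma[symmetric]) auto
  finally show ?thesis .
qed

theorem theorem1:
  fixes k :: nat
  assumes "k \<ge> 1"
  shows "\<exists>C::real. C > 0 \<and>
    (\<forall>(Q::nat) (N::nat) (I::int set) (P::int poly) (a::int \<Rightarrow> complex).
       Q \<ge> 1 \<longrightarrow> interval_of_length I N \<longrightarrow> degree P = k \<longrightarrow>
       (\<Sum>x\<in>farey Q. (cmod (\<Sum>i\<in>I. a i * e (of_rat x * of_int (poly P i))))\<^sup>2)
         \<le> C * (real Q * (real N + real Q) * log1 Q ^ (omega (lead_coeff P) + theta k)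
                * norm_sq I a))"
proof (intro exI[of _ "81 * 2 ^ theta k"] conjI allI impI)
  fix Q N :: nat and I :: "int set" and P :: "int poly" and a :: "int \<Rightarrow> complex"
  assume Q: "Q \<ge> 1" and "interval_of_length I N" and P: "degree P = k"
  then obtain m where I: "I = {m..<m + int N}"
    by (auto simp: interval_of_length_def)
  \<comment> \<open>This will bound, uniformly in \<open>i\<close>, the number of pairs
    \<open>(q, j)\<close> with \<open>q\<close> dividing \<open>P(j) - P(i)\<close>.\<close>
  define B where "B = 81 * 2 ^ theta k * (real N + real Q) * log1 Q ^ (omega (lead_coeff P) + theta k)"
  define c where "c q i = real (card {j\<in>I. q dvd poly P j - poly P i})" for q i
  have "(\<Sum>x\<in>farey Q. (cmod (\<Sum>i\<in>I. a i * e (of_rat x * of_int (poly P i))))\<^sup>2)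
      \<le> (\<Sum>q=1..int Q. \<Sum>r=0..<q.
          (cmod (\<Sum>i\<in>I. a i * e (of_rat (of_int r / of_int q) * of_int (poly P i))))\<^sup>2)"
    by (rule sum_farey_le) simp
  also have "\<dots> \<le> (\<Sum>q=1..int Q. real Q * (\<Sum>i\<in>I. (cmod (a i))\<^sup>2 * c q i))"
  proof (rule sum_mono)
    fix q assume q: "q \<in> {1..int Q}"
    have "(\<Sum>r=0..<q. (cmod (\<Sum>i\<in>I. a i * e (of_rat (of_int r / of_int q) * of_int (poly P i))))\<^sup>2)
        \<le> of_int q * (\<Sum>i\<in>I. (cmod (a i))\<^sup>2 * c q i)"
      using sum_residues_square_le[of I q a "poly P"] q I by (simp add: c_def of_rat_divide)
    \<comment> \<open>With the weight \<open>q\<close> replaced by \<open>Q\<close>, the sum over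
      \<open>q\<close> acts on the counts alone.\<close>
    also have "\<dots> \<le> real Q * (\<Sum>i\<in>I. (cmod (a i))\<^sup>2 * c q i)"
      using q by (intro mult_right_mono sum_nonneg) (auto simp: c_def)
    finally show "(\<Sum>r=0..<q. (cmod (\<Sum>i\<in>I. a i * e (of_rat (of_int r / of_int q) * of_int (poly P i))))\<^sup>2)
        \<le> real Q * (\<Sum>i\<in>I. (cmod (a i))\<^sup>2 * c q i)" .
  qed
  also have "\<dots> = real Q * (\<Sum>i\<in>I. (cmod (a i))\<^sup>2 * (\<Sum>q=1..int Q. c q i))"
    unfolding sum_distrib_left[symmetric] by (subst sum.swap) (simp add: sum_distrib_left)
  also have "\<dots> \<le> real Q * (\<Sum>i\<in>I. (cmod (a i))\<^sup>2 * B)"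
  proof (intro mult_left_mono sum_mono)
    fix i
    \<comment> \<open>As \<open>k \<ge> 1\<close>, subtracting a constant preserves the degree and
      the leading coefficient, so the bound does not depend on \<open>i\<close>.\<close>
    define f where "f = P - [:poly P i:]"
    have coeff: "coeff f n = coeff P n" if "n \<ge> 1" for n
      using that by (cases n) (simp_all add: f_def)
    have "degree f \<le> k"
      unfolding f_def by (rule degree_diff_le) (use P in auto)
    moreover have "coeff f k \<noteq> 0"
      using coeff[OF assms] P assms by auto
    ultimately have deg: "degree f = k"
      by (simp add: le_degree le_antisym)
    have "(\<Sum>q=1..int Q. c q i) = (\<Sum>q=1..int Q. real (card {j\<in>{m..<m + int N}. q dvd poly f j}))"
      by (simp add: c_def f_def I)
    also have "\<dots> \<le> B"
      using sum_card_dvd_le[OF assms deg Q, of m N] coeff[OF assms] P by (simp add: B_def deg)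
    finally show "(\<Sum>q=1..int Q. c q i) \<le> B" .
  qed auto
  also have "\<dots> = 81 * 2 ^ theta k * (real Q * (real N + real Q)
      * log1 Q ^ (omega (lead_coeff P) + theta k) * norm_sq I a)"
    by (simp add: B_def norm_sq_def sum_distrib_left sum_distrib_right mult_ac)
  finally show "(\<Sum>x\<in>farey Q. (cmod (\<Sum>i\<in>I. a i * e (of_rat x * of_int (poly P i))))\<^sup>2)
      \<le> 81 * 2 ^ theta k * (real Q * (real N + real Q)
      * log1 Q ^ (omega (lead_coeff P) + theta k) * norm_sq I a)" .
qed simp

end
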